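(* Let $a,m$ be integers with $2\le a\le m-1$, let $\gamma=a\,1\,2\cdots(a-1)\,(a+1)\cdots m\in\mathcal S_m$ (that is, $a$ followed by the remaining elements of $\{1,\dots,m\}$ in increasing order), and let $B=B(t,x)=\sum_{n\ge 0}t^n\sum_{\sigma\in\mathcal S_n(132)}x^{\gamma\text{-mch}(\sigma)}$. Then $$B=\frac{1+t^{m-1}B^{m-a}(x-1)(B-1)}{1-tB}.$$
   Context: $\mathcal S_n$ is the set of permutations of $\{1,\dots,n\}$ in one-line notation ($\mathcal S_0$ contains only the empty permutation, on which all statistics are $0$). For a word $w$ of distinct integers, $\mathrm{red}(w)$ replaces the $i$-th smallest letter by $i$. $\sigma\in\mathcal S_n$ avoids $\lambda\in\mathcal S_k$ (classical avoidance) if no (not necessarily contiguous) subsequence $\sigma_{i_1}\cdots\sigma_{i_k}$, $i_1<\dots<i_k$, has reduction $\lambda$; $\mathcal S_n(\lambda)$ is the set of such $\sigma$. $\gamma\text{-mch}(\sigma)$ is the number of $i$ with $\mathrm{red}(\sigma_i\sigma_{i+1}\cdots\sigma_{i+k-1})=\gamma$ for $\gamma\in\mathcal S_k$. The identity is one of formal power series in $t$ over $\mathbb Q[x]$. *)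

theory Defs
  imports
    "HOL-Combinatorics.Multiset_Permutations"
    "HOL-Computational_Algebra.Formal_Power_Series"
    "HOL-Computational_Algebra.Polynomial"
    "HOL-Library.Sublist"
begin

definition red :: "'a::linorder list \<Rightarrow> nat list" where
  "red w = map (\<lambda>c. card {d \<in> set w. d \<le> c}) w"

definition perms :: "nat \<Rightarrow> nat list set" where
  "perms n = permutations_of_set {1..n}"

definition contains_pattern :: "nat list \<Rightarrow> nat list \<Rightarrow> bool" where
  "contains_pattern \<sigma> p \<longleftrightarrow> (\<exists>s. subseq s \<sigma> \<and> red s = p)"

definition avoiders :: "nat \<Rightarrow> nat list \<Rightarrow> nat list set" where
  "avoiders n p = {\<sigma> \<in> perms n. \<not> contains_pattern \<sigma> p}"

(* Start positions i are counted from 0. *)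
definition mch :: "nat list \<Rightarrow> nat list \<Rightarrow> nat" where
  "mch \<gamma> \<sigma> = card {i. i + length \<gamma> \<le> length \<sigma> \<and> red (take (length \<gamma>) (drop i \<sigma>)) = \<gamma>}"

definition gamma_perm :: "nat \<Rightarrow> nat \<Rightarrow> nat list" where
  "gamma_perm a m = a # [1..<a] @ [a + 1..<m + 1]"

(* The power series variable is t; the coefficient polynomials are in x. *)
definition mch_gf :: "nat list \<Rightarrow> nat list \<Rightarrow> rat poly fps" where
  "mch_gf p \<gamma> = Abs_fps (\<lambda>n. \<Sum>\<sigma>\<in>avoiders n p. monom 1 (mch \<gamma> \<sigma>))"

definition x_var :: "rat poly fps" where
  "x_var = fps_const (monom 1 1)"

(* The library's inverse (and hence division) of power series needs an inverse operation on the
   coefficients, which rat poly lacks. The reciprocal of a series G with constant coefficient 1 is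
   therefore written fps_right_inverse G 1; the following lemmas confirm that it is the
   multiplicative inverse of G and that multiplying by it is division by G. *)
lemma fps_right_inverse_unit:
  fixes G :: "rat poly fps"
  assumes "fps_nth G 0 = 1"
  shows "G * fps_right_inverse G 1 = 1"
  by (rule fps_right_inverse) (simp add: assms)

lemma fps_right_inverse_quotient_iff:
  fixes F G H :: "rat poly fps"
  assumes "fps_nth G 0 = 1"
  shows "F = H * fps_right_inverse G 1 \<longleftrightarrow> F * G = H"
proof
  assume "F = H * fps_right_inverse G 1"
  hence "F * G = H * (G * fps_right_inverse G 1)"
    by (simp only: mult.assoc mult.commute mult.left_commute)
  thus "F * G = H"
    by (simp only: fps_right_inverse_unit[OF assms] mult_1_right)
next
  assume "F * G = H"
  hence "H * fps_right_inverse G 1 = F * (G * fps_right_inverse G 1)"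
    by (simp only: mult.assoc[symmetric])
  thus "F = H * fps_right_inverse G 1"
    by (simp only: fps_right_inverse_unit[OF assms] mult_1_right)
qed

end

theory Submission
  imports Defs
begin

text \<open>
  A nonempty 132-avoider is \<open>L n R\<close> with \<open>n\<close> its maximum, every letter of \<open>L\<close> above every letter of
  \<open>R\<close>, and \<open>L\<close>, \<open>R\<close> arbitrary 132-avoiders. Write \<open>\<gamma>\<^sub>k\<close> for \<open>gamma_perm a k\<close>. As \<open>\<gamma>\<^sub>m\<close> ends with its
  maximum, a match through \<open>n\<close> consists of \<open>n\<close> and a suffix of \<open>L\<close> that reduces to \<open>\<gamma>\<^bsub>m-1\<^esub>\<close>. So let \<open>E\<^sub>k\<close>
  count the avoiders that end in \<open>\<gamma>\<^sub>k\<close>; with \<open>U = B + (x - 1) E\<^bsub>m-1\<^esub>\<close> the decomposition gives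
  \<open>B = 1 + t U B\<close>, \<open>E\<^sub>k = t (U E\<^sub>k + E\<^bsub>k-1\<^esub>)\<close> for \<open>a < k < m\<close>, and \<open>E\<^sub>a = t U (E\<^sub>a + t\<^bsup>a-1\<^esup>)\<close>. Since
  \<open>B\<close> is the inverse of \<open>1 - t U\<close>, this solves to \<open>E\<^bsub>m-1\<^esub> = t\<^bsup>m-2\<^esup> B\<^bsup>m-1-a\<^esup> (B - 1)\<close>.
\<close>

unbundle fps_syntax

section \<open>Reduction of words through ranks of letters\<close>

text \<open>The letter function hidden in \<open>red\<close>: with it, \<open>red w\<close> is a
  \<open>map\<close> over \<open>w\<close>, so that facts about single letters suffice.\<close>

definition rank :: "'a::linorder set \<Rightarrow> 'a \<Rightarrow> nat" where
  "rank A c = card {d \<in> A. d \<le> c}"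

lemma red_eq_map_rank: "red w = map (rank (set w)) w"
  by (simp add: red_def rank_def)

lemma length_red [simp]: "length (red w) = length w"
  by (simp add: red_def)

lemma rank_mono:
  assumes "finite A" "c \<le> d"
  shows "rank A c \<le> rank A d"
  unfolding rank_def using assms by (intro card_mono) auto

lemma rank_less_imp_less:
  assumes "finite A" "rank A c < rank A d"
  shows "c < d"
  using rank_mono[OF assms(1), of d c] assms(2) by (meson leD not_le_imp_less)

lemma rank_eq_card_imp_max:
  assumes "finite A" "card A \<le> rank A c" "d \<in> A"
  shows "d \<le> c"
proof -
  have "{d \<in> A. d \<le> c} = A"
    using assms by (intro card_seteq) (auto simp: rank_def)
  thus ?thesis using assms(3) by auto
qed

lemma rank_insert_greater:
  assumes "c < N"
  shows "rank (insert N A) c = rank A c"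
proof -
  have "{d \<in> insert N A. d \<le> c} = {d \<in> A. d \<le> c}"
    using assms by auto
  thus ?thesis by (simp add: rank_def)
qed

lemma rank_insert_max:
  assumes "finite A" "\<And>x. x \<in> A \<Longrightarrow> x < N"
  shows "rank (insert N A) N = Suc (card A)"
proof -
  have "{d \<in> insert N A. d \<le> N} = insert N A"
    using assms(2) by (auto intro: less_imp_le)
  moreover have "N \<notin> A" using assms(2) by blast
  ultimately show ?thesis using assms(1) by (simp add: rank_def)
qed

lemma red_snoc_max:
  assumes "distinct v" "\<And>x. x \<in> set v \<Longrightarrow> x < N"
  shows "red (v @ [N]) = red v @ [Suc (length v)]"
  using assms by (simp add: red_eq_map_rank rank_insert_greater rank_insert_max distinct_card)

lemma red_Cons_max:
  assumes "distinct v" "\<And>x. x \<in> set v \<Longrightarrow> x < N"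
  shows "red (N # v) = Suc (length v) # red v"
  using assms by (simp add: red_eq_map_rank rank_insert_greater rank_insert_max distinct_card)

lemma red_map_strict_mono:
  assumes "strict_mono f"
  shows "red (map f w) = red w"
proof -
  have "rank (f ` A) (f c) = rank A c" for A c
  proof -
    have "{d \<in> f ` A. d \<le> f c} = f ` {d \<in> A. d \<le> c}"
      using assms by (auto simp: strict_mono_less_eq)
    thus ?thesis
      using strict_mono_imp_inj_on[OF assms]
      by (simp add: rank_def card_image inj_on_subset)
  qed
  thus ?thesis by (simp add: red_eq_map_rank)
qed

lemma red_perms:
  assumes "w \<in> perms n"
  shows "red w = w"
proof -
  have s: "set w = {1..n}"
    using assms by (simp add: perms_def permutations_of_set_def)
  have "rank {1..n} c = c" if "c \<in> {1..n}" for c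
  proof -
    have "{d \<in> {1..n}. d \<le> c} = {1..c}" using that by auto
    thus ?thesis by (simp add: rank_def)
  qed
  hence "map (rank {1..n}) w = w" by (intro map_idI) (simp add: s)
  thus ?thesis by (simp add: red_eq_map_rank s)
qed

section \<open>Avoidance of 132\<close>

lemma red_132_iff: "red s = [1, 3, 2] \<longleftrightarrow> (\<exists>p q r. s = [p, q, r] \<and> p < r \<and> r < q)"
  for s :: "'a::linorder list"
proof
  assume *: "red s = [1, 3, 2]"
  hence "length s = 3" by (metis length_red length_Cons list.size(3) numeral_3_eq_3)
  then obtain p q r where s: "s = [p, q, r]"
    by (auto simp: numeral_3_eq_3 length_Suc_conv)
  have "rank {p, q, r} p = 1" "rank {p, q, r} q = 3" "rank {p, q, r} r = 2"
    using * by (auto simp: s red_eq_map_rank)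
  hence "p < r" "r < q"
    by (auto intro!: rank_less_imp_less[of "{p, q, r}"])
  thus "\<exists>p q r. s = [p, q, r] \<and> p < r \<and> r < q" using s by blast
next
  assume "\<exists>p q r. s = [p, q, r] \<and> p < r \<and> r < q"
  then obtain p q r where s: "s = [p, q, r]" and l: "p < r" "r < q" by blast
  have "{d \<in> {p, q, r}. d \<le> p} = {p}" "{d \<in> {p, q, r}. d \<le> q} = {p, q, r}"
    "{d \<in> {p, q, r}. d \<le> r} = {p, r}"
    using l by auto
  hence "rank {p, q, r} p = 1" "rank {p, q, r} q = 3" "rank {p, q, r} r = 2"
    using l by (auto simp: rank_def)
  thus "red s = [1, 3, 2]" by (simp add: s red_eq_map_rank)
qed

text \<open>Avoidance in terms of order alone, for words that need not be permutations: the part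
  left of the maximum uses a shifted alphabet.\<close>

definition av132 :: "'a::linorder list \<Rightarrow> bool" where
  "av132 w \<longleftrightarrow> (\<forall>p q r. subseq [p, q, r] w \<longrightarrow> \<not> (p < r \<and> r < q))"

definition Av132 :: "nat \<Rightarrow> nat list set" where
  "Av132 n = avoiders n [1, 3, 2]"

lemma Av132_iff:
  "\<sigma> \<in> Av132 n \<longleftrightarrow> set \<sigma> = {1..n} \<and> distinct \<sigma> \<and> av132 \<sigma>"
  unfolding Av132_def avoiders_def perms_def permutations_of_set_def contains_pattern_def av132_def
    red_132_iff
  by blast

lemma length_Av132: "\<sigma> \<in> Av132 n \<Longrightarrow> length \<sigma> = n"
  by (auto simp: Av132_iff dest: distinct_card)

lemma finite_Av132 [simp]: "finite (Av132 n)"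
  by (auto simp: Av132_def avoiders_def perms_def)

lemma Av132_0: "Av132 0 = {[]}"
  by (auto simp: Av132_iff av132_def)

lemma av132_subseq: "av132 w \<Longrightarrow> subseq v w \<Longrightarrow> av132 v"
  unfolding av132_def using subseq_order.trans by blast

text \<open>Subsequences of \<open>map f w\<close> are the images of subsequences of
  \<open>w\<close>, and \<open>red\<close> does not see \<open>f\<close>; hence the detour through
  \<open>red s = [1, 3, 2]\<close>.\<close>

lemma av132_map:
  assumes "strict_mono f"
  shows "av132 (map f w) \<longleftrightarrow> av132 w"
proof -
  have "(\<exists>s. subseq s (map f w) \<and> red s = [1, 3, 2]) \<longleftrightarrow> (\<exists>s. subseq s w \<and> red s = [1, 3, 2])"
  proof
    assume "\<exists>s. subseq s w \<and> red s = [1, 3, 2]"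
    thus "\<exists>s. subseq s (map f w) \<and> red s = [1, 3, 2]"
      using red_map_strict_mono[OF assms] subseq_map by metis
  next
    assume "\<exists>s. subseq s (map f w) \<and> red s = [1, 3, 2]"
    then obtain s where s: "subseq s (map f w)" "red s = [1, 3, 2]" by blast
    from s(1) obtain N where "s = nths (map f w) N" using subseq_conv_nths by metis
    hence "s = map f (nths w N)" by (simp add: nths_map)
    thus "\<exists>s. subseq s w \<and> red s = [1, 3, 2]"
      using s(2) red_map_strict_mono[OF assms] subseq_conv_nths by metis
  qed
  thus ?thesis unfolding av132_def red_132_iff by blast
qed

text \<open>A smaller letter of \<open>u\<close>, then \<open>N\<close>, then a larger letter of
  \<open>v\<close> would form 132. Conversely, \<open>N\<close> can only play the 3, and once
  \<open>u\<close> lies above \<open>v\<close> no occurrence has its 1 in \<open>u\<close> and its 2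
  in \<open>v\<close>.\<close>

lemma av132_append_max:
  assumes "\<And>x. x \<in> set u \<Longrightarrow> x < N" "\<And>x. x \<in> set v \<Longrightarrow> x < N" "distinct (u @ N # v)"
  shows "av132 (u @ N # v) \<longleftrightarrow> av132 u \<and> av132 v \<and> (\<forall>p\<in>set u. \<forall>r\<in>set v. r < p)"
    (is "?l \<longleftrightarrow> ?r")
proof
  assume l: ?l
  have "subseq u (u @ N # v)" using list_emb_append_mono[of "(=)" u u "[]" "N # v"] by simp
  moreover have "subseq v (u @ N # v)"
    using list_emb_append2[of "(=)" v "N # v" u] by auto
  moreover have "r < p" if "p \<in> set u" "r \<in> set v" for p r
  proof -
    have "subseq ([p] @ ([N] @ [r])) (u @ ([N] @ v))"
      using that by (intro list_emb_append_mono) (auto simp: subseq_singleton_left)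
    hence "\<not> p < r" using l assms(2)[OF that(2)] by (auto simp: av132_def)
    moreover have "p \<noteq> r" using that assms(3) by auto
    ultimately show ?thesis by simp
  qed
  ultimately show ?r using l av132_subseq by blast
next
  assume r: ?r
  have False if s: "subseq [p, q, r] (u @ N # v)" and l: "p < r" "r < q" for p q r
  proof -
    from s obtain s1 s2 where e: "[p, q, r] = s1 @ s2" and
      s1: "subseq s1 u" and s2: "subseq s2 (N # v)"
      by (auto simp: subseq_append_iff)
    have i1: "set s1 \<subseteq> set u" and i2: "set s2 \<subseteq> insert N (set v)"
      using list_emb_set[OF s1] list_emb_set[OF s2] by auto
    \<comment> \<open>The cases: nothing before \<open>N\<close>, everything before
      \<open>N\<close>, or a cut that separates \<open>p\<close> from \<open>r\<close>. In the last
      one the place of \<open>q\<close> is irrelevant.\<close>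
    consider "s1 = []" "s2 = [p, q, r]" | "s1 = [p, q, r]" | "p \<in> set s1" "r \<in> set s2"
      using e by (cases s1; cases s2) (auto simp: Cons_eq_append_conv)
    thus False
    proof cases
      case 1
      hence "subseq [p, q, r] (N # v)" using s2 by simp
      moreover have "q \<in> insert N (set v)" using i2 1 by auto
      ultimately have "p = N \<or> subseq [p, q, r] v"
        by (auto split: if_splits)
      moreover have "p \<noteq> N" using l i2 1 assms(2) by fastforce
      ultimately show False using r l by (auto simp: av132_def)
    next
      case 2
      thus False using r l s1 by (auto simp: av132_def)
    next
      case 3
      hence "p \<in> set u" "r = N \<or> r \<in> set v" using i1 i2 by auto
      moreover have "q \<in> set u \<union> insert N (set v)"
        using i1 i2 e by (metis Un_iff list.set_intros(1) list.set_intros(2) set_append subsetD)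
      hence "q \<le> N" using assms(1,2) by (auto intro: less_imp_le)
      ultimately show False using r l by fastforce
    qed
  qed
  thus ?l by (auto simp: av132_def)
qed

section \<open>Decomposition of 132-avoiders at their maximum\<close>

text \<open>The inverse of the decomposition: \<open>L\<close> is lifted above the letters of
  \<open>R\<close>, while \<open>R\<close>, already a permutation of an initial segment, stays as it
  is.\<close>

definition glue :: "nat list \<Rightarrow> nat list \<Rightarrow> nat list" where
  "glue L R = map ((+) (length R)) L @ Suc (length L + length R) # R"

lemma image_plus_atLeastAtMost_1: "(+) j ` {1..i} = {j + 1..j + i::nat}"
  by (simp add: add.commute)

lemma glue_Av132:
  assumes L: "L \<in> Av132 i" and R: "R \<in> Av132 j"
  shows "glue L R \<in> Av132 (Suc (i + j))"
proof -
  note l = length_Av132[OF L] length_Av132[OF R]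
  have sm: "strict_mono ((+) j)" by (simp add: strict_mono_def)
  have sL: "set (map ((+) j) L) = {j + 1..j + i}"
    using L image_plus_atLeastAtMost_1[of j i] by (auto simp: Av132_iff)
  have sR: "set R = {1..j}" using R by (auto simp: Av132_iff)
  have d: "distinct (glue L R)"
    using L R sL sR l by (auto simp: glue_def distinct_map Av132_iff)
  have "av132 (glue L R)" unfolding glue_def l
  proof (subst av132_append_max)
    show "distinct (map ((+) j) L @ Suc (i + j) # R)" using d l by (simp add: glue_def)
  qed (use L R sL sR sm in \<open>auto simp: Av132_iff av132_map simp del: set_map\<close>)
  moreover have "set (glue L R) = {1..Suc (i + j)}"
    using sL sR l by (auto simp: glue_def simp del: set_map)
  ultimately show ?thesis using d by (auto simp: Av132_iff)
qed

text \<open>As all letters left of the maximum exceed those right of it, the right part occupies an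
  initial segment \<open>{1..j}\<close> and the left part becomes a permutation when lowered by
  \<open>j\<close>.\<close>

lemma Av132_SucE:
  assumes "\<sigma> \<in> Av132 (Suc n)"
  obtains i L R where "i \<le> n" "L \<in> Av132 i" "R \<in> Av132 (n - i)"
    "\<sigma> = glue L R"
proof -
  have s: "set \<sigma> = {1..Suc n}" "distinct \<sigma>" "av132 \<sigma>"
    using assms by (auto simp: Av132_iff)
  have "Suc n \<in> set \<sigma>" using s by auto
  then obtain u R where \<sigma>: "\<sigma> = u @ Suc n # R" by (meson split_list)
  have dis: "set u \<inter> set R = {}" "Suc n \<notin> set u" "Suc n \<notin> set R" "distinct u" "distinct R"
    using s(2) by (auto simp: \<sigma>)
  have "insert (Suc n) (set u \<union> set R) = {1..Suc n}" using s(1) by (simp add: \<sigma>)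
  hence un: "set u \<union> set R = {1..n}"
  proof -
    have "set u \<union> set R = insert (Suc n) (set u \<union> set R) - {Suc n}" using dis by blast
    also have "\<dots> = {1..Suc n} - {Suc n}" using \<open>insert _ _ = _\<close> by simp
    also have "\<dots> = {1..n}" by auto
    finally show ?thesis .
  qed
  have lt: "\<And>x. x \<in> set u \<Longrightarrow> x < Suc n" "\<And>x. x \<in> set R \<Longrightarrow> x < Suc n"
    using un by (metis UnI1 atLeastAtMost_iff le_imp_less_Suc, metis UnI2 atLeastAtMost_iff le_imp_less_Suc)
  have av: "av132 u" "av132 R" and gr: "\<And>p r. p \<in> set u \<Longrightarrow> r \<in> set R \<Longrightarrow> r < p"
    using av132_append_max[of u "Suc n" R] lt s(2,3) by (auto simp: \<sigma>)
  define j where "j = length R"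
  have cR: "card (set R) = j" using dis by (simp add: j_def distinct_card)
  \<comment> \<open>The set of letters of \<open>R\<close> is closed downwards: a letter below
    \<open>r\<close> cannot lie in \<open>u\<close>, whose letters exceed \<open>r\<close>. Counting
    \<open>{1..r}\<close> then bounds \<open>r\<close>.\<close>
  have "r \<le> j" if "r \<in> set R" for r
  proof -
    have "{1..r} \<subseteq> set R"
    proof
      fix y assume y: "y \<in> {1..r}"
      have "r \<in> {1..n}" using un that by blast
      hence "y \<in> set u \<union> set R" using y un by auto
      moreover have "y \<notin> set u" using gr[OF _ that] y by fastforce
      ultimately show "y \<in> set R" by blast
    qed
    hence "card {1..r} \<le> j" using card_mono cR by (metis List.finite_set)
    thus ?thesis by simp
  qed
  hence "set R \<subseteq> {1..j}" using un by force
  hence sR: "set R = {1..j}" using cR by (intro card_seteq) auto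
  have jn: "j \<le> n" using un sR by (cases "j = 0") auto
  have su: "set u = {j + 1..n}"
  proof -
    have "set u = {1..n} - {1..j}" using un dis sR by blast
    also have "\<dots> = {j + 1..n}" by auto
    finally show ?thesis .
  qed
  define L where "L = map (\<lambda>x. x - j) u"
  have uL: "u = map ((+) j) L"
    unfolding L_def map_map by (rule map_idI[symmetric]) (auto simp: su)
  have "(+) j ` set L = (+) j ` {1..n - j}"
    using su jn image_plus_atLeastAtMost_1[of j "n - j"] unfolding uL by simp
  hence sL: "set L = {1..n - j}" by (rule inj_image_eq_iff[THEN iffD1, rotated]) simp
  have "L \<in> Av132 (n - j)"
    using sL av(1) dis(4) by (simp add: Av132_iff uL av132_map strict_mono_def distinct_map)
  moreover have "R \<in> Av132 (n - (n - j))"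
    using sR jn av dis by (simp add: Av132_iff)
  moreover have "\<sigma> = glue L R"
    using length_Av132[OF calculation(1)] jn by (simp add: glue_def \<sigma> uL j_def)
  ultimately show ?thesis using that[of "n - j"] by simp
qed

text \<open>This turns sums over avoiders into convolutions. Injectivity holds because
  \<open>Suc n\<close> occurs only once, so its position determines both parts.\<close>

lemma bij_betw_glue:
  "bij_betw (\<lambda>(i, L, R). glue L R)
     (SIGMA i:{0..n}. Av132 i \<times> Av132 (n - i))
     (Av132 (Suc n))"
  unfolding bij_betw_def
proof (intro conjI)
  show "inj_on (\<lambda>(i, L, R). glue L R)
     (SIGMA i:{0..n}. Av132 i \<times> Av132 (n - i))"
  proof (rule inj_onI, clarsimp)
    fix i L R i' L' R'
    assume i: "i \<le> n" "i' \<le> n"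
      and mem: "L \<in> Av132 i" "R \<in> Av132 (n - i)"
        "L' \<in> Av132 i'" "R' \<in> Av132 (n - i')"
      and eq: "glue L R = glue L' R'"
    note l = mem[THEN length_Av132]
    have s: "set L = {1..i}" "set R = {1..n - i}" "set L' = {1..i'}" "set R' = {1..n - i'}"
      using mem by (auto simp: Av132_iff)
    have "map ((+) (n - i)) L @ Suc n # R = map ((+) (n - i')) L' @ Suc n # R'"
      using eq i by (simp add: glue_def l)
    moreover have "Suc n \<notin> set (map ((+) (n - i)) L)" "Suc n \<notin> set R"
      using i s by auto
    ultimately have *: "map ((+) (n - i)) L = map ((+) (n - i')) L'" "R = R'"
      by (auto simp: append_Cons_eq_iff)
    hence "length L = length L'" by (metis length_map)
    hence ii: "i = i'" using l by simp
    have "L = L'" using *(1) unfolding ii by (auto dest: map_injective simp: inj_def)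
    with ii * show "i = i' \<and> L = L' \<and> R = R'" by simp
  qed
  show "(\<lambda>(i, L, R). glue L R) `
     (SIGMA i:{0..n}. Av132 i \<times> Av132 (n - i)) = Av132 (Suc n)"
  proof
    show "(\<lambda>(i, L, R). glue L R) `
       (SIGMA i:{0..n}. Av132 i \<times> Av132 (n - i)) \<subseteq> Av132 (Suc n)"
      using glue_Av132 by fastforce
    show "Av132 (Suc n) \<subseteq> (\<lambda>(i, L, R). glue L R) `
       (SIGMA i:{0..n}. Av132 i \<times> Av132 (n - i))"
    proof
      fix \<sigma> assume "\<sigma> \<in> Av132 (Suc n)"
      then obtain i L R where "i \<le> n" "L \<in> Av132 i" "R \<in> Av132 (n - i)"
        "\<sigma> = glue L R" by (rule Av132_SucE)
      thus "\<sigma> \<in> (\<lambda>(i, L, R). glue L R) `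
       (SIGMA i:{0..n}. Av132 i \<times> Av132 (n - i))"
        by (intro image_eqI[of _ _ "(i, L, R)"]) auto
    qed
  qed
qed

section \<open>Generating functions of weighted avoiders\<close>

text \<open>The weight is left arbitrary so that \<open>B\<close> and all the series for suffix
  matches are instances.\<close>

definition gf :: "(nat list \<Rightarrow> 'a::comm_ring_1) \<Rightarrow> 'a fps" where
  "gf W = Abs_fps (\<lambda>n. \<Sum>\<sigma>\<in>Av132 n. W \<sigma>)"

lemma gf_add: "gf (\<lambda>\<sigma>. V \<sigma> + W \<sigma>) = gf V + gf W"
  by (rule fps_ext) (simp add: gf_def sum.distrib)

lemma gf_mult_const: "gf (\<lambda>\<sigma>. c * W \<sigma>) = fps_const c * gf W"
  by (rule fps_ext) (simp add: gf_def sum_distrib_left)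

lemma gf_0: "gf (\<lambda>_. 0) = 0"
  by (rule fps_ext) (simp add: gf_def)

lemma gf_of_bool_eq:
  assumes "\<tau> \<in> Av132 k"
  shows "gf (\<lambda>\<sigma>. of_bool (\<sigma> = \<tau>)) = fps_X ^ k"
proof (rule fps_ext)
  fix n
  have "(\<Sum>\<sigma>\<in>Av132 n. of_bool (\<sigma> = \<tau>)) =
      (if \<tau> \<in> Av132 n then 1 else 0 :: 'a)"
    by (simp add: of_bool_def sum.delta)
  also have "\<dots> = (if n = k then 1 else 0)"
    using assms length_Av132 by metis
  finally show "gf (\<lambda>\<sigma>. of_bool (\<sigma> = \<tau>)) $ n = (fps_X ^ k :: 'a fps) $ n"
    by (simp add: gf_def fps_X_power_nth)
qed

text \<open>Each product of a weight of \<open>L\<close> and a weight of \<open>R\<close> becomes a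
  product of series; \<open>fps_X\<close> accounts for the maximum and the constant for the empty
  permutation. The second product carries the inhomogeneous term of the equations for suffix
  matches.\<close>

lemma gf_glue:
  assumes "\<And>i j L R. L \<in> Av132 i \<Longrightarrow> R \<in> Av132 j \<Longrightarrow>
      W (glue L R) = U L * V R + U' L * V' R"
  shows "gf W = fps_const (W []) + fps_X * (gf U * gf V + gf U' * gf V')"
proof (rule fps_ext)
  fix n
  show "gf W $ n = (fps_const (W []) + fps_X * (gf U * gf V + gf U' * gf V')) $ n"
  proof (cases n)
    case 0
    thus ?thesis by (simp add: gf_def Av132_0)
  next
    case (Suc n')
    let ?A = Av132
    have "gf W $ n = (\<Sum>\<sigma>\<in>?A (Suc n'). W \<sigma>)" by (simp add: gf_def Suc)
    also have "\<dots> = (\<Sum>(i, L, R)\<in>(SIGMA i:{0..n'}. ?A i \<times> ?A (n' - i)). W (glue L R))"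
      by (subst sum.reindex_bij_betw[OF bij_betw_glue, symmetric]) (simp add: case_prod_beta)
    also have "\<dots> = (\<Sum>i=0..n'. \<Sum>(L, R)\<in>?A i \<times> ?A (n' - i). W (glue L R))"
      by (subst sum.Sigma) (auto simp: case_prod_beta)
    also have "\<dots> = (\<Sum>i=0..n'. gf U $ i * gf V $ (n' - i) + gf U' $ i * gf V' $ (n' - i))"
    proof (rule sum.cong[OF refl])
      fix i
      have "(\<Sum>(L, R)\<in>?A i \<times> ?A (n' - i). W (glue L R)) =
          (\<Sum>L\<in>?A i. \<Sum>R\<in>?A (n' - i). U L * V R + U' L * V' R)"
        by (simp add: sum.cartesian_product[symmetric] assms cong: sum.cong)
      thus "(\<Sum>(L, R)\<in>?A i \<times> ?A (n' - i). W (glue L R)) =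
          gf U $ i * gf V $ (n' - i) + gf U' $ i * gf V' $ (n' - i)"
        by (simp add: gf_def sum_product sum.distrib)
    qed
    finally show ?thesis by (simp add: Suc fps_mult_nth[of "gf _"] sum.distrib)
  qed
qed

section \<open>Suffix matches and consecutive matches\<close>

text \<open>Quantifying over the split, rather than cutting off \<open>length p\<close> letters,
  yields a recursion from the front that matches the one for \<open>mch\<close>.\<close>

definition ends_in :: "nat list \<Rightarrow> nat list \<Rightarrow> bool" where
  "ends_in p \<sigma> \<longleftrightarrow> (\<exists>u v. \<sigma> = u @ v \<and> red v = p)"

lemma ends_in_Nil [simp]: "ends_in p [] \<longleftrightarrow> p = []"
  by (auto simp: ends_in_def red_def)

lemma ends_in_Cons: "ends_in p (x # w) \<longleftrightarrow> red (x # w) = p \<or> ends_in p w"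
  unfolding ends_in_def by (auto simp: Cons_eq_append_conv)

lemma ends_in_length: "ends_in p w \<Longrightarrow> length p \<le> length w"
  by (auto simp: ends_in_def)

lemma ends_in_map:
  assumes "strict_mono f"
  shows "ends_in p (map f w) \<longleftrightarrow> ends_in p w"
proof (induction w)
  case (Cons x w)
  have "red (f x # map f w) = red (x # w)"
    using red_map_strict_mono[OF assms, of "x # w"] by simp
  thus ?case using Cons by (simp add: ends_in_Cons)
qed simp

lemma mch_Nil: "p \<noteq> [] \<Longrightarrow> mch p [] = 0"
  by (simp add: mch_def)

lemma mch_Cons:
  assumes "p \<noteq> []"
  shows "mch p (x # w) = of_bool (red (take (length p) (x # w)) = p) + mch p w"
proof -
  let ?S = "\<lambda>w. {i. i + length p \<le> length w \<and> red (take (length p) (drop i w)) = p}"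
  have fin: "finite (?S w)" for w by (rule finite_subset[of _ "{..length w}"]) auto
  have 0: "0 \<in> ?S (x # w) \<longleftrightarrow> red (take (length p) (x # w)) = p"
  proof -
    \<comment> \<open>A truncated window has too short a reduction, so the equation with
      \<open>p\<close> already enforces that the window fits.\<close>
    have "length p \<le> length (x # w)" if "red (take (length p) (x # w)) = p"
      using arg_cong[OF that, of length] by simp
    thus ?thesis by auto
  qed
  have "i \<in> ?S (x # w) \<longleftrightarrow> i = 0 \<and> red (take (length p) (x # w)) = p \<or> i \<in> Suc ` ?S w" for i
    using 0 by (cases i) auto
  hence "?S (x # w) = {i. i = 0 \<and> red (take (length p) (x # w)) = p} \<union> Suc ` ?S w"
    by blast
  moreover have "card \<dots> = card {i::nat. i = 0 \<and> red (take (length p) (x # w)) = p} + card (Suc ` ?S w)"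
    using fin by (intro card_Un_disjoint) auto
  ultimately show ?thesis by (simp add: mch_def card_image)
qed

lemma mch_map:
  assumes "strict_mono f" "p \<noteq> []"
  shows "mch p (map f w) = mch p w"
proof (induction w)
  case (Cons x w)
  have "red (take k (f x # map f w)) = red (take k (x # w))" for k
    using red_map_strict_mono[OF assms(1), of "take k (x # w)"] by (metis take_map list.simps(9))
  thus ?case using Cons by (simp add: mch_Cons assms(2))
qed simp

lemma mch_short: "length w < length p \<Longrightarrow> mch p w = 0"
  by (simp add: mch_def)

section \<open>The patterns \<open>gamma_perm a k\<close> and their matches around a maximum\<close>

lemma length_gamma_perm: "1 \<le> a \<Longrightarrow> a \<le> k \<Longrightarrow> length (gamma_perm a k) = k"
  by (simp add: gamma_perm_def)

lemma gamma_perm_Suc: "a \<le> k \<Longrightarrow> gamma_perm a (Suc k) = gamma_perm a k @ [Suc k]"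
  by (simp add: gamma_perm_def)

text \<open>For \<open>a < k\<close> the last letter of the pattern is \<open>k\<close>, the highest
  possible rank.\<close>

lemma red_gamma_perm_last_max:
  assumes "a \<ge> 1" "a < k" "red v = gamma_perm a k" "x \<in> set v"
  shows "x \<le> last v"
proof -
  have ne: "v \<noteq> []" using assms(4) by auto
  obtain k' where k: "k = Suc k'" "a \<le> k'" using assms(2) by (cases k) auto
  have "rank (set v) (last v) = last (red v)" using ne by (simp add: red_eq_map_rank last_map)
  also have "\<dots> = k" using k by (simp add: assms(3) gamma_perm_Suc)
  also have "k = length v" using assms length_gamma_perm by (metis length_red less_imp_le)
  finally have "card (set v) \<le> rank (set v) (last v)" by (simp add: card_length)
  thus ?thesis using assms(4) rank_eq_card_imp_max by blast
qed

text \<open>The boundary case \<open>k = a\<close>: nothing follows \<open>a - 1\<close>, so the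
  maximum stands first instead of last.\<close>

lemma red_gamma_perm_hd_max:
  assumes "a \<ge> 1" "red v = gamma_perm a a" "x \<in> set v"
  shows "x \<le> hd v"
proof -
  have ne: "v \<noteq> []" using assms by auto
  have "rank (set v) (hd v) = hd (red v)" using ne by (simp add: red_eq_map_rank hd_map)
  also have "\<dots> = a" by (simp add: assms(2) gamma_perm_def)
  also have "a = length v" using assms length_gamma_perm by (metis length_red order_refl)
  finally have "card (set v) \<le> rank (set v) (hd v)" by (simp add: card_length)
  thus ?thesis using assms(3) rank_eq_card_imp_max by blast
qed

lemma red_snoc_max_eq_gamma_perm_iff:
  assumes "1 \<le> a" "a \<le> k" "distinct v" "\<And>x. x \<in> set v \<Longrightarrow> x < N"
  shows "red (v @ [N]) = gamma_perm a (Suc k) \<longleftrightarrow> red v = gamma_perm a k"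
proof -
  have "length v = k" if "red v = gamma_perm a k"
    using arg_cong[OF that, of length] assms by (simp add: length_gamma_perm)
  thus ?thesis using assms by (auto simp: red_snoc_max gamma_perm_Suc)
qed

text \<open>The last descent of a word ending in the pattern of size \<open>k\<close> is at distance \<open>k\<close> from its end.\<close>

lemma ends_in_gamma_perm_unique:
  assumes "2 \<le> a" "a \<le> j" "j < k" "ends_in (gamma_perm a j) w"
  shows "\<not> ends_in (gamma_perm a k) w"
proof
  assume "ends_in (gamma_perm a k) w"
  then obtain u v where w: "w = u @ v" and v: "red v = gamma_perm a k" by (auto simp: ends_in_def)
  obtain u' v' where w': "w = u' @ v'" and v': "red v' = gamma_perm a j"
    using assms(4) by (auto simp: ends_in_def)
  have lv: "length v = k" "length v' = j"
    using arg_cong[OF v, of length] arg_cong[OF v', of length] assms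
    by (simp_all add: length_gamma_perm)
  obtain c s where cs: "v = c # s" using lv assms by (cases v) auto
  have "map (rank (set v)) s = [1..<a] @ [a + 1..<k + 1]"
    using v by (simp add: cs red_eq_map_rank gamma_perm_def)
  hence "sorted_wrt (<) (map (rank (set v)) s)" by (auto simp: sorted_wrt_append)
  hence "sorted_wrt (\<lambda>x y. rank (set v) x < rank (set v) y) s" by (simp add: sorted_wrt_map)
  hence srt: "sorted_wrt (<) s"
    by (rule sorted_wrt_mono_rel[rotated]) (auto intro: rank_less_imp_less)
  have "suffix v' (c # s)"
    using lv assms w w' cs
    by (metis suffix_def suffix_length_suffix less_imp_le)
  \<comment> \<open>Since \<open>j < k\<close>, the shorter suffix misses the first letter
    \<open>c\<close> and lies in the increasing part \<open>s\<close>.\<close>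
  hence "suffix v' s" using lv cs assms by (auto simp: suffix_Cons)
  hence srt': "sorted_wrt (<) v'" using srt by (auto simp: suffix_def sorted_wrt_append)
  obtain x y t where xyt: "v' = x # y # t"
    using lv assms by (cases v'; cases "tl v'") auto
  \<comment> \<open>Here \<open>2 \<le> a\<close> enters: the pattern begins with the descent from
    \<open>a\<close> to 1, which cannot occur in an increasing word.\<close>
  have "[1..<a] = 1 # [2..<a]" using assms by (simp add: upt_conv_Cons numeral_2_eq_2)
  hence "rank (set v') x = a" "rank (set v') y = 1"
    using v' by (simp_all add: xyt red_eq_map_rank gamma_perm_def)
  hence "rank (set v') y < rank (set v') x" using assms(1) by linarith
  hence "y < x" by (rule rank_less_imp_less[rotated]) simp
  thus False using srt' by (simp add: xyt)
qed

text \<open>The pattern of size \<open>Suc k\<close> ends with its maximum, so a match through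
  \<open>N\<close> must end at \<open>N\<close>, and its first \<open>k\<close> letters are a suffix
  of \<open>u\<close> reducing to the pattern of size \<open>k\<close>. The induction on
  \<open>u\<close> removes one start position at a time.\<close>

lemma mch_append_max:
  assumes a: "2 \<le> a" "a \<le> k" and "distinct u"
    and "\<And>x. x \<in> set u \<Longrightarrow> x < N" "\<And>x. x \<in> set v \<Longrightarrow> x < N"
  shows "mch (gamma_perm a (Suc k)) (u @ N # v) =
    mch (gamma_perm a (Suc k)) u + of_bool (ends_in (gamma_perm a k) u) + mch (gamma_perm a (Suc k)) v"
  using assms(3,4)
proof (induction u)
  let ?g = "gamma_perm a (Suc k)" and ?h = "gamma_perm a k"
  have ne: "?g \<noteq> []" "?h \<noteq> []" and lg: "length ?g = Suc k" "length ?h = k"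
    using a by (simp_all add: gamma_perm_def)
  \<comment> \<open>A window reaching beyond \<open>N\<close> has its maximum before its last
    letter.\<close>
  have not_last: "red (u @ N # w) \<noteq> ?g" if "w \<noteq> []" "set w \<subseteq> set v" for u w
  proof
    assume "red (u @ N # w) = ?g"
    hence "N \<le> last (u @ N # w)" using a by (intro red_gamma_perm_last_max[of a "Suc k"]) auto
    moreover have "last (u @ N # w) \<in> set v" using that by auto
    ultimately show False using assms(5) by fastforce
  qed
  {
    case Nil
    have "red (take (Suc k) (N # v)) \<noteq> ?g"
    proof (cases "take k v = []")
      case True
      hence "red (take (Suc k) (N # v)) = red [N]" by (metis take_Suc_Cons)
      moreover have "length (red [N]) \<noteq> length ?g" using a by (simp add: lg)
      ultimately show ?thesis by metis
    next
      case False
      thus ?thesis using not_last[of "take k v" "[]"] by (simp add: set_take_subset)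
    qed
    thus ?case by (simp add: mch_Cons mch_Nil ne lg)
  next
    case (Cons x u)
    let ?u = "x # u"
    have key: "of_bool (red (take (Suc k) (?u @ N # v)) = ?g) =
      of_bool (red (take (Suc k) ?u) = ?g) + (of_bool (red ?u = ?h) :: nat)"
    proof -
      \<comment> \<open>The window starting at \<open>x\<close> stays inside \<open>?u\<close>, ends
        exactly at \<open>N\<close>, or has room to go beyond \<open>N\<close>, where it is cut
        short only if \<open>v\<close> is empty.\<close>
      consider "Suc k \<le> length ?u" | "length ?u = k" | "length ?u < k" by linarith
      thus ?thesis
      proof cases
        case 1
        hence "length (red ?u) \<noteq> length ?h" by (simp add: lg)
        hence "red ?u \<noteq> ?h" by metis
        thus ?thesis using 1 by simp
      next
        case 2
        have "length (red (take (Suc k) ?u)) \<noteq> length ?g" using 2 by (simp add: lg)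
        hence "red (take (Suc k) ?u) \<noteq> ?g" by metis
        moreover have "take (Suc k) (?u @ N # v) = ?u @ [N]" unfolding 2[symmetric] by simp
        moreover have "red (?u @ [N]) = ?g \<longleftrightarrow> red ?u = ?h"
          using a Cons.prems by (intro red_snoc_max_eq_gamma_perm_iff) auto
        ultimately show ?thesis by simp
      next
        case 3
        have "length (red (take (Suc k) ?u)) \<noteq> length ?g" "length (red ?u) \<noteq> length ?h"
          using 3 by (simp_all add: lg)
        hence "red (take (Suc k) ?u) \<noteq> ?g" "red ?u \<noteq> ?h" by metis+
        moreover have "red (take (Suc k) (?u @ N # v)) \<noteq> ?g"
        proof (cases "take (k - length ?u) v = []")
          case True
          hence "take (Suc k) (?u @ N # v) = ?u @ [N]" using 3 by (auto simp: take_Cons')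
          moreover have "length (red (?u @ [N])) \<noteq> length ?g" using 3 by (simp add: lg)
          ultimately show ?thesis by metis
        next
          case False
          have "take (Suc k) (?u @ N # v) = ?u @ N # take (k - length ?u) v"
            using 3 by (simp add: take_Cons' Suc_diff_le)
          thus ?thesis using not_last[OF False, of ?u] by (simp add: set_take_subset)
        qed
        ultimately show ?thesis by simp
      qed
    qed
    \<comment> \<open>Only one suffix has length \<open>k\<close>, so the indicators for
      \<open>?u\<close> itself and for \<open>u\<close> add up to a single indicator.\<close>
    have excl: "\<not> (red ?u = ?h \<and> ends_in ?h u)"
      using ends_in_length[of ?h u] length_red[of ?u] by force
    have "mch ?g (?u @ N # v) = of_bool (red (take (Suc k) (?u @ N # v)) = ?g) + mch ?g (u @ N # v)"
      using mch_Cons[OF ne(1), of x "u @ N # v"] by (simp add: lg)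
    thus ?case using Cons excl unfolding key
      by (auto simp: mch_Cons ne lg ends_in_Cons)
  }
qed


section \<open>Suffix matches in glued words\<close>

lemma ends_in_append:
  "ends_in p (u @ w) \<longleftrightarrow> ends_in p w \<or> (\<exists>u' v. u = u' @ v \<and> v \<noteq> [] \<and> red (v @ w) = p)"
proof (induction u)
  case (Cons x u)
  have "(\<exists>u' v. x # u = u' @ v \<and> v \<noteq> [] \<and> red (v @ w) = p) \<longleftrightarrow>
      red (x # u @ w) = p \<or> (\<exists>u' v. u = u' @ v \<and> v \<noteq> [] \<and> red (v @ w) = p)"
    by (auto simp: Cons_eq_append_conv intro: exI[of _ "[]"])
  thus ?case using Cons by (auto simp: ends_in_Cons)
qed simp

text \<open>Hides the concrete shift behind a strictly monotone \<open>f\<close>, which is all that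
  the invariance of \<open>mch\<close> and \<open>ends_in\<close> requires.\<close>

lemma glue_shift:
  assumes L: "L \<in> Av132 i" and R: "R \<in> Av132 j"
  obtains f :: "nat \<Rightarrow> nat" where "strict_mono f" "glue L R = map f L @ Suc (i + j) # R"
    "\<And>x. x \<in> set (map f L) \<Longrightarrow> x < Suc (i + j)" "\<And>x. x \<in> set R \<Longrightarrow> x < Suc (i + j)"
    "distinct (map f L)"
proof (rule that)
  show "strict_mono ((+) j)" by (simp add: strict_mono_def)
  show "glue L R = map ((+) j) L @ Suc (i + j) # R"
    using L R by (simp add: glue_def length_Av132)
qed (use L R in \<open>auto simp: Av132_iff distinct_map\<close>)

lemma mch_glue:
  assumes "2 \<le> a" "a \<le> k" "L \<in> Av132 i" "R \<in> Av132 j"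
  shows "mch (gamma_perm a (Suc k)) (glue L R) =
    mch (gamma_perm a (Suc k)) L + of_bool (ends_in (gamma_perm a k) L) + mch (gamma_perm a (Suc k)) R"
proof -
  obtain f :: "nat \<Rightarrow> nat" where f: "strict_mono f" "glue L R = map f L @ Suc (i + j) # R"
    "\<And>x. x \<in> set (map f L) \<Longrightarrow> x < Suc (i + j)" "\<And>x. x \<in> set R \<Longrightarrow> x < Suc (i + j)"
    "distinct (map f L)"
    using glue_shift[OF assms(3,4)] by metis
  have "gamma_perm a (Suc k) \<noteq> []" by (simp add: gamma_perm_def)
  moreover have "mch (gamma_perm a (Suc k)) (map f L @ Suc (i + j) # R) =
    mch (gamma_perm a (Suc k)) (map f L) + of_bool (ends_in (gamma_perm a k) (map f L)) +
    mch (gamma_perm a (Suc k)) R"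
    using f(3-5) by (intro mch_append_max[OF assms(1,2)]) blast+
  ultimately show ?thesis
    by (simp add: f(2) mch_map[OF f(1)] ends_in_map[OF f(1)])
qed

text \<open>The pattern ends with its maximum. If \<open>R\<close> is empty, the final
  \<open>N\<close> plays this maximum and the rest matches at the end of \<open>L\<close>; otherwise
  a suffix through \<open>N\<close> has its maximum too early, so the match lies in
  \<open>R\<close>.\<close>

lemma ends_in_glue_gt:
  assumes a: "1 \<le> a" "a \<le> k" and LR: "L \<in> Av132 i" "R \<in> Av132 j"
  shows "ends_in (gamma_perm a (Suc k)) (glue L R) \<longleftrightarrow>
    (if R = [] then ends_in (gamma_perm a k) L else ends_in (gamma_perm a (Suc k)) R)"
proof -
  define N where "N = Suc (i + j)"
  obtain f :: "nat \<Rightarrow> nat" where f: "strict_mono f" "glue L R = map f L @ N # R"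
    "\<And>x. x \<in> set (map f L) \<Longrightarrow> x < N" "\<And>x. x \<in> set R \<Longrightarrow> x < N"
    "distinct (map f L)"
    unfolding N_def using glue_shift[OF LR] by metis
  show ?thesis
  proof (cases "R = []")
    case True
    have iff: "red (v @ [N]) = gamma_perm a (Suc k) \<longleftrightarrow> red v = gamma_perm a k"
      if "map f L = u @ v" for u v
    proof (rule red_snoc_max_eq_gamma_perm_iff[OF a])
      show "distinct v" using f(5) by (simp add: that)
      show "x < N" if "x \<in> set v" for x
        using f(3)[of x] that \<open>map f L = u @ v\<close> by simp
    qed
    have len: "length (gamma_perm a (Suc k)) = Suc k" "length (gamma_perm a k) = k"
      using a by (simp_all add: length_gamma_perm)
    have "\<not> ends_in (gamma_perm a (Suc k)) [N]"
      using ends_in_length[of "gamma_perm a (Suc k)" "[N]"] a by (auto simp: len)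
    hence "ends_in (gamma_perm a (Suc k)) (glue L R) \<longleftrightarrow>
        (\<exists>u v. map f L = u @ v \<and> v \<noteq> [] \<and> red (v @ [N]) = gamma_perm a (Suc k))"
      using f(2) by (simp only: True ends_in_append simp_thms)
    also have "\<dots> \<longleftrightarrow> (\<exists>u v. map f L = u @ v \<and> v \<noteq> [] \<and> red v = gamma_perm a k)"
      by (intro iff_exI conj_cong refl iff)
    also have "\<dots> \<longleftrightarrow> ends_in (gamma_perm a k) (map f L)"
    proof -
      have "red [] \<noteq> gamma_perm a k" by (simp add: red_def gamma_perm_def)
      thus ?thesis unfolding ends_in_def by metis
    qed
    finally show ?thesis using True by (simp add: ends_in_map[OF f(1)])
  next
    case False
    have "red (v @ N # R) \<noteq> gamma_perm a (Suc k)" for v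
    proof
      assume "red (v @ N # R) = gamma_perm a (Suc k)"
      hence "N \<le> last (v @ N # R)" using a by (intro red_gamma_perm_last_max[of a "Suc k"]) auto
      thus False using f(4)[of "last R"] False by simp
    qed
    from this this[of "[]"] show ?thesis using False
      by (simp add: f(2) ends_in_append ends_in_Cons)
  qed
qed

text \<open>This pattern begins with its maximum, so a matching suffix that contains
  \<open>N\<close> starts there, and what follows is all of \<open>R\<close>.\<close>

lemma ends_in_glue_eq:
  assumes a: "2 \<le> a" and LR: "L \<in> Av132 i" "R \<in> Av132 j"
  shows "ends_in (gamma_perm a a) (glue L R) \<longleftrightarrow> R = [1..<a] \<or> ends_in (gamma_perm a a) R"
proof -
  define N where "N = Suc (i + j)"
  obtain f :: "nat \<Rightarrow> nat" where f: "strict_mono f" "glue L R = map f L @ N # R"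
    "\<And>x. x \<in> set (map f L) \<Longrightarrow> x < N" "\<And>x. x \<in> set R \<Longrightarrow> x < N"
    unfolding N_def using glue_shift[OF LR] by metis
  have "red (v @ N # R) \<noteq> gamma_perm a a" if "map f L = u @ v" "v \<noteq> []" for u v
  proof
    assume "red (v @ N # R) = gamma_perm a a"
    hence "N \<le> hd (v @ N # R)" using a by (intro red_gamma_perm_hd_max[of a]) auto
    thus False using f(3)[of "hd v"] that by simp
  qed
  moreover have "red (N # R) = gamma_perm a a \<longleftrightarrow> R = [1..<a]"
  proof -
    \<comment> \<open>As a permutation, \<open>R\<close> is its own reduction, so a match at
      \<open>N\<close> determines \<open>R\<close> itself and not only its order type.\<close>
    have "distinct R" "red R = R"
      using LR(2) red_perms[of R j] by (simp add: Av132_iff, simp add: Av132_def avoiders_def)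
    hence "red (N # R) = Suc (length R) # R"
      using f(4) by (simp add: red_Cons_max)
    thus ?thesis using a by (auto simp: gamma_perm_def)
  qed
  ultimately show ?thesis by (auto simp: f(2) ends_in_append ends_in_Cons)
qed

lemma upt_in_Av132: "[1..<Suc n] \<in> Av132 n"
proof -
  have "av132 [1..<Suc n]"
  proof -
    have "sorted s" if "subseq s [1..<Suc n]" for s
      using that sorted_nths[of "[1..<Suc n]"] by (auto simp: subseq_conv_nths simp del: upt_Suc)
    thus ?thesis unfolding av132_def by fastforce
  qed
  thus ?thesis by (auto simp: Av132_iff simp del: upt_Suc)
qed

section \<open>Solution of the linear system\<close>

text \<open>Every equation has the form \<open>e = fps_X * (U * e) + d\<close> with solution
  \<open>B * d\<close>. At the start \<open>fps_X * (U * B)\<close> is \<open>B - 1\<close>; each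
  further step contributes a factor \<open>fps_X * B\<close>.\<close>

lemma linear_fps_system_132:
  fixes B U :: "'a::comm_ring_1 fps" and E :: "nat \<Rightarrow> 'a fps"
  assumes B: "B = 1 + fps_X * (U * B)"
    and E_start: "E a = fps_X * (U * E a + U * fps_X ^ (a - 1))"
    and E_step: "\<And>k. a \<le> k \<Longrightarrow> k < n \<Longrightarrow> E (Suc k) = fps_X * (U * E (Suc k) + E k)"
    and "1 \<le> a" "a \<le> k" "k \<le> n"
  shows "E k = fps_X ^ (k - 1) * B ^ (k - a) * (B - 1)"
  using \<open>a \<le> k\<close> \<open>k \<le> n\<close>
proof (induction k rule: dec_induct)
  have solve: "e = B * d" if "e = fps_X * (U * e) + d" for d e
  proof -
    \<comment> \<open>The same expression is simplified twice, once by the equation for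
      \<open>e\<close> and once by the one for \<open>B\<close>.\<close>
    have "e * B - fps_X * U * e * B = d * B" by (subst (1) that) (simp add: algebra_simps)
    moreover have "e * B - fps_X * U * e * B = e" by (subst (1) B) (simp add: algebra_simps)
    ultimately show ?thesis by (simp add: mult.commute)
  qed
  {
    case base
    have "E a = B * (fps_X * (U * fps_X ^ (a - 1)))"
      using E_start by (intro solve) (simp add: algebra_simps)
    also have "\<dots> = fps_X ^ (a - 1) * (fps_X * (U * B))" by (simp add: algebra_simps)
    also have "fps_X * (U * B) = B - 1" by (subst (2) B) simp
    finally show ?case by simp
  next
    case (step k)
    have "E (Suc k) = B * (fps_X * E k)"
      using E_step[of k] step.hyps step.prems by (intro solve) (simp add: algebra_simps)
    also have "E k = fps_X ^ (k - 1) * B ^ (k - a) * (B - 1)" using step by simp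
    also have "B * (fps_X * (fps_X ^ (k - 1) * B ^ (k - a) * (B - 1))) =
        (fps_X * fps_X ^ (k - 1)) * (B * B ^ (k - a)) * (B - 1)" by (simp only: ac_simps)
    also have "\<dots> = fps_X ^ k * B ^ (Suc k - a) * (B - 1)"
      using step(1) \<open>1 \<le> a\<close> by (simp add: Suc_diff_le flip: power_Suc)
    finally show ?case by simp
  }
qed

section \<open>The functional equation for \<open>B\<close>\<close>

theorem theorem13:
  fixes a m :: nat and \<gamma> :: "nat list" and B :: "rat poly fps"
  assumes "2 \<le> a" and "a \<le> m - 1"
    and "\<gamma> = gamma_perm a m"
    and "B = mch_gf [1, 3, 2] \<gamma>"
  shows "B = (1 + fps_X ^ (m - 1) * B ^ (m - a) * (x_var - 1) * (B - 1))
             * fps_right_inverse (1 - fps_X * B) 1"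
proof -
  define n where "n = m - 1"
  have m: "m = Suc n" and an: "a \<le> n" using assms(1,2) by (auto simp: n_def)
  have \<gamma>: "\<gamma> = gamma_perm a (Suc n)" by (simp add: assms(3) m)
  have ne: "\<gamma> \<noteq> []" by (simp add: \<gamma> gamma_perm_def)
  define c :: "rat poly" where "c = monom 1 1 - 1"
  define W :: "nat list \<Rightarrow> rat poly" where "W = (\<lambda>\<sigma>. monom 1 (mch \<gamma> \<sigma>))"
  define E :: "nat \<Rightarrow> nat list \<Rightarrow> rat poly" where
    "E = (\<lambda>k \<sigma>. of_bool (ends_in (gamma_perm a k) \<sigma>) * W \<sigma>)"
  \<comment> \<open>The contribution of \<open>L\<close> to a glued word: \<open>c\<close> is x - 1,
    so \<open>U\<close> multiplies \<open>W\<close> by x exactly when the maximum placed after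
    \<open>L\<close> completes a match.\<close>
  define U :: "nat list \<Rightarrow> rat poly" where "U = (\<lambda>\<sigma>. W \<sigma> + c * E n \<sigma>)"
  have B: "B = gf W" by (simp add: assms(4) mch_gf_def gf_def W_def Av132_def)
  have gfU: "gf U = B + fps_const c * gf (E n)"
    by (simp add: U_def B gf_add gf_mult_const)
  have W_Nil: "W [] = 1" by (simp add: W_def mch_Nil ne)
  have E_Nil: "E k [] = 0" for k by (simp add: E_def gamma_perm_def)
  have W_glue: "W (glue L R) = U L * W R" if "L \<in> Av132 i" "R \<in> Av132 j" for i j L R
  proof -
    have "monom 1 (Suc p + q) = (monom 1 p + c * monom 1 p) * (monom 1 q :: rat poly)" for p q
      by (simp add: c_def algebra_simps mult_monom)
    thus ?thesis
      using mch_glue[OF assms(1) an that]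
      by (auto simp: W_def U_def E_def \<gamma> mult_monom)
  qed
  have gf_W: "gf W = 1 + fps_X * (gf U * gf W)"
    using gf_glue[of W U W "\<lambda>_. 0" "\<lambda>_. 0"] W_glue by (simp add: W_Nil gf_0)
  have gf_E_start: "gf (E a) = fps_X * (gf U * gf (E a) + gf U * fps_X ^ (a - 1))"
  proof -
    have E_glue: "E a (glue L R) = U L * E a R + U L * of_bool (R = [1..<a])"
      if LR: "L \<in> Av132 i" "R \<in> Av132 j" for i j L R
    proof (cases "R = [1..<a]")
      case True
      \<comment> \<open>With only \<open>a - 1\<close> letters, this \<open>R\<close> can neither
        end in the pattern of size \<open>a\<close> nor contain \<open>\<gamma>\<close>; hence the
        two alternatives exclude each other and \<open>R\<close> has weight 1.\<close>
      have "length R < length (gamma_perm a a)" "length R < length \<gamma>"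
        using assms(1) an by (simp_all add: True length_gamma_perm \<gamma>)
      hence "\<not> ends_in (gamma_perm a a) R" "W R = 1"
        using ends_in_length by (force, simp add: W_def mch_short)
      thus ?thesis
        using ends_in_glue_eq[OF assms(1) LR] W_glue[OF LR] True by (simp add: E_def)
    next
      case False
      thus ?thesis using ends_in_glue_eq[OF assms(1) LR] W_glue[OF LR] by (simp add: E_def)
    qed
    have "[1..<a] \<in> Av132 (a - 1)" using upt_in_Av132[of "a - 1"] assms(1) by simp
    thus ?thesis
      using gf_glue[of "E a" U "E a" U "\<lambda>R. of_bool (R = [1..<a])"] E_glue
      by (simp add: E_Nil gf_of_bool_eq)
  qed
  have gf_E_step: "gf (E (Suc k)) = fps_X * (gf U * gf (E (Suc k)) + gf (E k))"
    if k: "a \<le> k" "k < n" for k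
  proof -
    have E_glue: "E (Suc k) (glue L R) = U L * E (Suc k) R + E k L * of_bool (R = [])"
      if LR: "L \<in> Av132 i" "R \<in> Av132 j" for i j L R
    proof (cases "R = []")
      case True
      \<comment> \<open>A word ending in the pattern of size \<open>k < n\<close> does not end in
        the one of size \<open>n\<close>, so the correction term of \<open>U\<close>
        vanishes.\<close>
      have "U L = W L" if "ends_in (gamma_perm a k) L"
        using ends_in_gamma_perm_unique[OF assms(1) k that] by (simp add: U_def E_def)
      thus ?thesis
        using ends_in_glue_gt[OF _ k(1) LR] W_glue[OF LR] assms(1) True
        by (auto simp: E_def W_Nil gamma_perm_def)
    next
      case False
      thus ?thesis
        using ends_in_glue_gt[OF _ k(1) LR] W_glue[OF LR] assms(1) by (simp add: E_def)
    qed
    have "[] \<in> Av132 0" by (simp add: Av132_0)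
    thus ?thesis
      using gf_glue[of "E (Suc k)" U "E (Suc k)" "E k" "\<lambda>R. of_bool (R = [])"] E_glue
      by (simp add: E_Nil gf_of_bool_eq)
  qed
  have E_n: "gf (E n) = fps_X ^ (n - 1) * B ^ (n - a) * (B - 1)"
    using assms(1) an gf_W gf_E_start gf_E_step unfolding B
    by (intro linear_fps_system_132[where U = "gf U" and n = n and E = "\<lambda>k. gf (E k)"]) auto
  \<comment> \<open>The factors \<open>fps_X\<close> and \<open>B\<close> from the equation for
    \<open>B\<close> raise the exponents \<open>n - 1\<close> and \<open>n - a\<close> by one. Both
    differences are genuine because \<open>2 \<le> a\<close> and \<open>a \<le> n\<close>.\<close>
  have pows: "fps_X * fps_X ^ (n - 1) = (fps_X ^ n :: rat poly fps)" "B * B ^ (n - a) = B ^ (m - a)"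
    using assms(1) an by (simp_all add: m Suc_diff_le flip: power_Suc)
  have x: "x_var - 1 = fps_const c"
    by (simp add: x_var_def c_def flip: fps_const_sub)
  have "B = 1 + fps_X * ((B + fps_const c * (fps_X ^ (n - 1) * B ^ (n - a) * (B - 1))) * B)"
    using gf_W unfolding gfU E_n B[symmetric] .
  hence "B * (1 - fps_X * B) =
      1 + (fps_X * fps_X ^ (n - 1)) * (B * B ^ (n - a)) * fps_const c * (B - 1)"
    by (simp add: algebra_simps)
  hence "B * (1 - fps_X * B) = 1 + fps_X ^ (m - 1) * B ^ (m - a) * (x_var - 1) * (B - 1)"
    unfolding pows x by (simp add: m)
  \<comment> \<open>The denominator has constant term 1, so the quotient is equivalent to the
    product form just obtained.\<close>
  thus ?thesis by (subst fps_right_inverse_quotient_iff) simp_all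
qed

end
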